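(* There exist $d\in\mathbb{N}$ and an infinite and connected $d$-bounded graph $G$ of sub-exponential growth rate such that the adjacency operator $H:=A_G$ satisfies $$\Bigg(\bigcup_{H'\in\mathcal{R}(H)}\sigma_\infty(H')\Bigg)\Big\backslash\,\sigma_{\mathrm{ess}}(H)\neq\emptyset.$$
   Context: Graphs. A graph $G$ has a countable vertex set $V(G)$ and a set $E(G)$ of undirected edges, with no loops; $u\sim v$ means $(u,v)\in E(G)$, and $\deg(v)=\sharp\{u: u\sim v\}$. $(G,v_0)$ is a rooted $d$-bounded graph if $v_0\in V(G)$ is a fixed vertex (root) and $\deg(v)\le d$ for all $v$. $\mathrm{dist}$ is the combinatorial graph distance, $B_r(v)=\{u:\mathrm{dist}(u,v)\le r\}$; $B_r(v)$ also denotes the induced subgraph on this vertex set. $\ell^2(G)=\ell^2(V(G))$, $\ell^\infty(G)=\ell^\infty(V(G))$ (complex-valued functions). Sub-exponential growth rate. A connected graph $G$ with root $v_0$ is of sub-exponential growth rate if for each $\gamma>1$ there is $C=C_{\gamma,v_0}>0$ with $\sharp B_r(v_0)<C\gamma^r$ for every $r\in\mathbb{N}$. Schrödinger operators. A Schrödinger operator on a graph $G$ (connected, with uniformly bounded degree) is an operator of the form $(H\psi)(v)=\sum_{u\sim v}(\psi(u)-\psi(v))+W(v)\psi(v)$ with $W:V(G)\to\mathbb{R}$ bounded. It is bounded and self-adjoint on $\ell^2(G)$; the formula also defines $H\psi$ for every $\psi:V(G)\to\mathbb{C}$. The adjacency operator $A_G$ is the Schrödinger operator with $W(v)=\deg(v)$,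 i.e. $(A_G\psi)(v)=\sum_{u\sim v}\psi(u)$. The discrete spectrum $\sigma_{\mathrm{disc}}(H)$ is the set of isolated eigenvalues of finite multiplicity, and $\sigma_{\mathrm{ess}}(H)=\sigma(H)\setminus\sigma_{\mathrm{disc}}(H)$. A generalized eigenfunction of $H$ with eigenvalue $\lambda$ is a function $\psi:V(G)\to\mathbb{C}$, $\psi\not\equiv0$, with $(H\psi)(v)=\lambda\psi(v)$ for all $v$. $\sigma_\infty(H)$ is the set of all $\lambda$ for which there is a bounded generalized eigenfunction $\psi\in\ell^\infty(G)$ with eigenvalue $\lambda$. Convergence. $P_{v,r}$ is multiplication by the characteristic function of $B_r(v)$, viewed as a map to $\ell^2(B_r(v))$ (embedded in $\ell^2(G)$ by extension by zero), and $H_{v,r}=P_{v,r}HP_{v,r}$ on $\ell^2(B_r(v))$. For a bijection $\eta:A\to B$ of finite sets, $\mathcal{I}_\eta:\ell^2(A)\to\ell^2(B)$ is the isomorphism with $\mathcal{I}_\eta(\delta_a)=\delta_{\eta(a)}$. A family of maps $f_r:B_r(v)\to B_r(v')$, $r\in\{0,1,2,\dots\}$, is coherent if $f_s|_{B_r(v)}=f_r$ for all $s>r$ (in particular $f_r(v)=v'$). Let $H_n$ be Schrödinger operators on connected rooted $d$-bounded graphs $(G_n,v_n)$ and $H'$ a Schrödinger operator on a connected rooted graph $(G',v_0')$. Then $\{(H_n,G_n,v_n)\}_n$ converges to $(H',G',v_0')$ if: (C1) for each $n$ there are coherent maps $f_{n,r}:B_r(v_n)\to B_r(v_0')$ such that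 for every $r$ there is $N_r$ such that $f_{n,r}$ is a graph isomorphism for all $n\ge N_r$; and (C2) for each $r$, $\lim_{n\to\infty}\|\mathcal{I}_{f_{n,r}}P_{v_n,r}H_nP_{v_n,r}\mathcal{I}_{f_{n,r}}^{-1}-H'_{v_0',r}\|=0$. $\mathcal{R}$-limits. A Schrödinger operator $H'$ on a graph $G'$ is an $\mathcal{R}$-limit of a Schrödinger operator $H$ on $G$ if there are a vertex $v_0'\in V(G')$ and a sequence $v_n\in V(G)$ with $\mathrm{dist}(v_0,v_n)\to\infty$ monotonically such that $\{(H,G,v_n)\}_n$ converges to $(H',G',v_0')$. $\mathcal{R}(H)$ is the set of all $\mathcal{R}$-limits of $H$. *)

theory Defs
  imports "HOL-Analysis.Analysis"
begin

section \<open>Graphs\<close>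

text \<open>An undirected edge between \<open>u\<close> and \<open>v\<close> is recorded as both pairs \<open>(u, v)\<close> and \<open>(v, u)\<close>.\<close>

record 'a ugraph =
  verts :: "'a set"
  edges :: "('a \<times> 'a) set"

definition is_graph :: "'a ugraph \<Rightarrow> bool" where
  "is_graph G \<longleftrightarrow> countable (verts G) \<and> edges G \<subseteq> verts G \<times> verts G \<and>
     sym (edges G) \<and> irrefl (edges G)"

definition nbrs :: "'a ugraph \<Rightarrow> 'a \<Rightarrow> 'a set" where
  "nbrs G v = {u. (u, v) \<in> edges G}"

definition deg :: "'a ugraph \<Rightarrow> 'a \<Rightarrow> nat" where
  "deg G v = card (nbrs G v)"

text \<open>Finiteness is required explicitly, since \<open>card\<close> of an infinite set is \<open>0\<close>.\<close>

definition degree_bounded :: "nat \<Rightarrow> 'a ugraph \<Rightarrow> bool" where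
  "degree_bounded d G \<longleftrightarrow> (\<forall>v\<in>verts G. finite (nbrs G v) \<and> deg G v \<le> d)"

definition connected_graph :: "'a ugraph \<Rightarrow> bool" where
  "connected_graph G \<longleftrightarrow> (\<forall>u\<in>verts G. \<forall>v\<in>verts G. (u, v) \<in> (edges G)\<^sup>*)"

text \<open>The least length of a walk from \<open>u\<close> to \<open>v\<close>; it is used for connected graphs only, where
  such walks exist.\<close>

definition gdist :: "'a ugraph \<Rightarrow> 'a \<Rightarrow> 'a \<Rightarrow> nat" where
  "gdist G u v = (LEAST n. (u, v) \<in> edges G ^^ n)"

definition gball :: "'a ugraph \<Rightarrow> 'a \<Rightarrow> nat \<Rightarrow> 'a set" where
  "gball G v r = {u \<in> verts G. gdist G u v \<le> r}"

definition subexponential_growth :: "'a ugraph \<Rightarrow> 'a \<Rightarrow> bool" where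
  "subexponential_growth G v0 \<longleftrightarrow>
     (\<forall>\<gamma>::real. \<gamma> > 1 \<longrightarrow> (\<exists>C>0. \<forall>r. real (card (gball G v0 r)) < C * \<gamma> ^ r))"

section \<open>Operators on square-summable functions\<close>

text \<open>A function on a set \<open>S\<close> in \<open>\<ell>\<^sup>2(S)\<close> is represented by its extension by zero to the whole type,
  so that \<open>\<ell>\<^sup>2(S)\<close> is a subset of \<open>\<ell>\<^sup>2(T)\<close> for \<open>S \<subseteq> T\<close>.\<close>

type_synonym 'a operator = "('a \<Rightarrow> complex) \<Rightarrow> ('a \<Rightarrow> complex)"

definition ell2 :: "'a set \<Rightarrow> ('a \<Rightarrow> complex) set" where
  "ell2 S = {\<psi>. (\<forall>v. v \<notin> S \<longrightarrow> \<psi> v = 0) \<and> (\<lambda>v. (cmod (\<psi> v))\<^sup>2) summable_on S}"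

definition ell2_norm :: "'a set \<Rightarrow> ('a \<Rightarrow> complex) \<Rightarrow> real" where
  "ell2_norm S \<psi> = sqrt (\<Sum>\<^sub>\<infinity>v\<in>S. (cmod (\<psi> v))\<^sup>2)"

definition bounded_operator :: "'a set \<Rightarrow> 'a operator \<Rightarrow> bool" where
  "bounded_operator S T \<longleftrightarrow>
     (\<forall>\<psi>\<in>ell2 S. T \<psi> \<in> ell2 S) \<and>
     (\<forall>\<phi>\<in>ell2 S. \<forall>\<psi>\<in>ell2 S. T (\<lambda>v. \<phi> v + \<psi> v) = (\<lambda>v. T \<phi> v + T \<psi> v)) \<and>
     (\<forall>c. \<forall>\<psi>\<in>ell2 S. T (\<lambda>v. c * \<psi> v) = (\<lambda>v. c * T \<psi> v)) \<and>
     (\<exists>K. \<forall>\<psi>\<in>ell2 S. ell2_norm S (T \<psi>) \<le> K * ell2_norm S \<psi>)"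

definition operator_norm :: "'a set \<Rightarrow> 'a operator \<Rightarrow> real" where
  "operator_norm S T = (SUP \<psi>\<in>{\<psi>\<in>ell2 S. ell2_norm S \<psi> \<le> 1}. ell2_norm S (T \<psi>))"

definition shifted :: "'a operator \<Rightarrow> complex \<Rightarrow> 'a operator" where
  "shifted T z \<psi> = (\<lambda>v. T \<psi> v - z * \<psi> v)"

definition resolvent_set :: "'a set \<Rightarrow> 'a operator \<Rightarrow> complex set" where
  "resolvent_set S T = {z. \<exists>R. bounded_operator S R \<and>
     (\<forall>\<psi>\<in>ell2 S. R (shifted T z \<psi>) = \<psi> \<and> shifted T z (R \<psi>) = \<psi>)}"

definition spectrum :: "'a set \<Rightarrow> 'a operator \<Rightarrow> complex set" where
  "spectrum S T = - resolvent_set S T"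

definition eigenspace :: "'a set \<Rightarrow> 'a operator \<Rightarrow> complex \<Rightarrow> ('a \<Rightarrow> complex) set" where
  "eigenspace S T z = {\<psi>\<in>ell2 S. T \<psi> = (\<lambda>v. z * \<psi> v)}"

definition finite_dimensional :: "('a \<Rightarrow> complex) set \<Rightarrow> bool" where
  "finite_dimensional X \<longleftrightarrow>
     (\<exists>B. finite B \<and> (\<forall>\<psi>\<in>X. \<exists>c. \<psi> = (\<lambda>v. \<Sum>b\<in>B. c b * b v)))"

definition disc_spectrum :: "'a set \<Rightarrow> 'a operator \<Rightarrow> complex set" where
  "disc_spectrum S T = {z. z isolated_in spectrum S T \<and>
     (\<exists>\<psi>\<in>eigenspace S T z. \<psi> \<noteq> (\<lambda>_. 0)) \<and> finite_dimensional (eigenspace S T z)}"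

definition ess_spectrum :: "'a set \<Rightarrow> 'a operator \<Rightarrow> complex set" where
  "ess_spectrum S T = spectrum S T - disc_spectrum S T"

section \<open>Schroedinger operators\<close>

definition schroedinger_op :: "'a ugraph \<Rightarrow> ('a \<Rightarrow> real) \<Rightarrow> 'a operator" where
  "schroedinger_op G W \<psi> =
     (\<lambda>v. if v \<in> verts G then (\<Sum>u\<in>nbrs G v. \<psi> u - \<psi> v) + of_real (W v) * \<psi> v else 0)"

definition is_schroedinger :: "'a ugraph \<Rightarrow> 'a operator \<Rightarrow> bool" where
  "is_schroedinger G H \<longleftrightarrow> is_graph G \<and> connected_graph G \<and> (\<exists>d. degree_bounded d G) \<and>
     (\<exists>W. bounded (W ` verts G) \<and> H = schroedinger_op G W)"

definition adjacency_op :: "'a ugraph \<Rightarrow> 'a operator" where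
  "adjacency_op G = schroedinger_op G (\<lambda>v. real (deg G v))"

lemma adjacency_op_eq:
  assumes "v \<in> verts G"
  shows "adjacency_op G \<psi> v = (\<Sum>u\<in>nbrs G v. \<psi> u)"
  using assms by (simp add: adjacency_op_def schroedinger_op_def deg_def sum_subtractf)

text \<open>Only the values of \<open>\<psi>\<close> on the vertices matter below.\<close>

definition generalized_eigenfunction ::
    "'a ugraph \<Rightarrow> 'a operator \<Rightarrow> complex \<Rightarrow> ('a \<Rightarrow> complex) \<Rightarrow> bool" where
  "generalized_eigenfunction G H z \<psi> \<longleftrightarrow>
     (\<exists>v\<in>verts G. \<psi> v \<noteq> 0) \<and> (\<forall>v\<in>verts G. H \<psi> v = z * \<psi> v)"

definition sigma_infty :: "'a ugraph \<Rightarrow> 'a operator \<Rightarrow> complex set" where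
  "sigma_infty G H =
     {z. \<exists>\<psi>. bounded (\<psi> ` verts G) \<and> generalized_eigenfunction G H z \<psi>}"

section \<open>Convergence and R-limits\<close>

definition coherent_maps ::
    "'a ugraph \<Rightarrow> 'a \<Rightarrow> 'b ugraph \<Rightarrow> 'b \<Rightarrow> (nat \<Rightarrow> 'a \<Rightarrow> 'b) \<Rightarrow> bool" where
  "coherent_maps G v G' v' f \<longleftrightarrow>
     (\<forall>r. f r ` gball G v r \<subseteq> gball G' v' r) \<and>
     (\<forall>r s. r < s \<longrightarrow> (\<forall>u\<in>gball G v r. f s u = f r u))"

text \<open>Isomorphism between the subgraphs induced on \<open>A\<close> and \<open>B\<close>.\<close>

definition induced_iso ::
    "'a ugraph \<Rightarrow> 'a set \<Rightarrow> 'b ugraph \<Rightarrow> 'b set \<Rightarrow> ('a \<Rightarrow> 'b) \<Rightarrow> bool" where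
  "induced_iso G A G' B f \<longleftrightarrow> bij_betw f A B \<and>
     (\<forall>x\<in>A. \<forall>y\<in>A. (x, y) \<in> edges G \<longleftrightarrow> (f x, f y) \<in> edges G')"

text \<open>The linear map \<open>\<I>\<^sub>\<eta>\<close> on \<open>\<ell>\<^sup>2(A)\<close>, \<open>A\<close> finite, sending the point mass at \<open>a\<close> to the point
  mass at \<open>\<eta> a\<close>.\<close>

definition transport :: "'a set \<Rightarrow> ('a \<Rightarrow> 'b) \<Rightarrow> ('a \<Rightarrow> complex) \<Rightarrow> ('b \<Rightarrow> complex)" where
  "transport A \<eta> \<psi> = (\<lambda>b. \<Sum>a\<in>{a\<in>A. \<eta> a = b}. \<psi> a)"

definition cutoff :: "'a set \<Rightarrow> 'a operator" where
  "cutoff S \<psi> = (\<lambda>v. if v \<in> S then \<psi> v else 0)"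

definition local_op :: "'a ugraph \<Rightarrow> 'a operator \<Rightarrow> 'a \<Rightarrow> nat \<Rightarrow> 'a operator" where
  "local_op G H v r = cutoff (gball G v r) \<circ> H \<circ> cutoff (gball G v r)"

text \<open>Below, \<open>\<I>\<^sub>\<eta>\<close> is inverted as the transport along the inverse of \<open>\<eta>\<close>. For fixed \<open>r\<close>, the maps
  \<open>f n r\<close> are bijections for all large \<open>n\<close>, and only these \<open>n\<close> influence the limit.\<close>

definition converges_to ::
    "(nat \<Rightarrow> 'a operator) \<Rightarrow> (nat \<Rightarrow> 'a ugraph) \<Rightarrow> (nat \<Rightarrow> 'a) \<Rightarrow>
     'b operator \<Rightarrow> 'b ugraph \<Rightarrow> 'b \<Rightarrow> bool" where
  "converges_to H G v H' G' v' \<longleftrightarrow>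
     (\<forall>n. is_schroedinger (G n) (H n) \<and> v n \<in> verts (G n)) \<and>
     (\<exists>d. \<forall>n. degree_bounded d (G n)) \<and>
     is_schroedinger G' H' \<and> v' \<in> verts G' \<and>
     (\<exists>f. (\<forall>n. coherent_maps (G n) (v n) G' v' (f n)) \<and>
          (\<forall>r. \<exists>N. \<forall>n\<ge>N. induced_iso (G n) (gball (G n) (v n) r) G' (gball G' v' r) (f n r)) \<and>
          (\<forall>r. (\<lambda>n. operator_norm (gball G' v' r)
                  (\<lambda>\<psi> b.
                    (transport (gball (G n) (v n) r) (f n r) \<circ>
                     local_op (G n) (H n) (v n) r \<circ>
                     transport (gball G' v' r) (inv_into (gball (G n) (v n) r) (f n r))) \<psi> b
                    - local_op G' H' v' r \<psi> b)) \<longlonglongrightarrow> 0))"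

definition R_limits :: "'a ugraph \<Rightarrow> 'a \<Rightarrow> 'a operator \<Rightarrow> ('b ugraph \<times> 'b operator) set" where
  "R_limits G v0 H = {(G', H'). is_schroedinger G' H' \<and>
     (\<exists>v'\<in>verts G'. \<exists>v. (\<forall>n. v n \<in> verts G) \<and>
        mono (\<lambda>n. gdist G v0 (v n)) \<and> filterlim (\<lambda>n. gdist G v0 (v n)) at_top sequentially \<and>
        converges_to (\<lambda>_. H) (\<lambda>_. G) v H' G' v')}"

end

theory Submission
  imports Defs
begin

text \<open>
  A tree with all degrees at most 3 has an adjacency operator of norm less than 3, because the
  weight \<open>(3/2) ^ height\<close>, with heights measured towards a fixed end, is a positive
  supersolution for \<open>17/6\<close>. On the 3-regular tree itself the constant function is a bounded
  generalized eigenfunction with eigenvalue 3. It remains to find a tree of polynomial growth that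
  contains arbitrarily large balls of the 3-regular tree: realise the latter on \<open>\<int> \<times> \<nat>\<close>,
  where \<open>(h, x)\<close> is joined to \<open>(h + 1, x div 2)\<close>, and take the subtree \<open>x \<le> h\<close>. The ball of
  radius \<open>r\<close> around \<open>(0, 0)\<close> in it has at most \<open>(r + 1)\<^sup>2\<close> vertices, whereas around \<open>(n, 0)\<close> it
  is a full ball of the 3-regular tree as soon as \<open>r + 2 ^ r \<le> n\<close>.
\<close>

section \<open>Square-summable functions through finite partial sums\<close>

lemma L2_set_le_ell2_norm:
  assumes "\<psi> \<in> ell2 S" "finite F" "F \<subseteq> S"
  shows "L2_set (\<lambda>v. cmod (\<psi> v)) F \<le> ell2_norm S \<psi>"
proof -
  have "(\<Sum>v\<in>F. (cmod (\<psi> v))\<^sup>2) \<le> (\<Sum>\<^sub>\<infinity>v\<in>S. (cmod (\<psi> v))\<^sup>2)"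
    using assms by (intro finite_sum_le_infsum) (auto simp: ell2_def)
  then show ?thesis
    by (simp add: L2_set_def ell2_norm_def)
qed

text \<open>Partial sums of nonnegative terms bounded uniformly over finite sets give summability
  and the same bound for the total. Later norm estimates therefore only have to treat finite
  \<open>F\<close>.\<close>

lemma ell2_boundI:
  assumes zero: "\<And>v. v \<notin> S \<Longrightarrow> \<psi> v = 0"
    and bound: "\<And>F. finite F \<Longrightarrow> F \<subseteq> S \<Longrightarrow> L2_set (\<lambda>v. cmod (\<psi> v)) F \<le> K"
  shows "\<psi> \<in> ell2 S" "ell2_norm S \<psi> \<le> K"
proof -
  \<comment> \<open>The empty set already forces \<open>K\<close> to be nonnegative, so squaring the
    bounds is legitimate.\<close>
  have K: "0 \<le> K" using bound[of "{}"] by simp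
  have sq: "(\<Sum>v\<in>F. (cmod (\<psi> v))\<^sup>2) \<le> K\<^sup>2" if "finite F" "F \<subseteq> S" for F
    using bound[OF that] K by (simp add: L2_set_def real_sqrt_le_iff real_le_lsqrt sqrt_le_D)
  have summable: "(\<lambda>v. (cmod (\<psi> v))\<^sup>2) summable_on S"
    by (rule nonneg_bdd_above_summable_on) (auto intro!: bdd_aboveI[of _ "K\<^sup>2"] sq)
  then show "\<psi> \<in> ell2 S" using zero by (simp add: ell2_def)
  have "(\<Sum>\<^sub>\<infinity>v\<in>S. (cmod (\<psi> v))\<^sup>2) \<le> K\<^sup>2"
    by (rule infsum_le_finite_sums[OF summable sq])
  then show "ell2_norm S \<psi> \<le> K"
    unfolding ell2_norm_def using K by (intro real_le_lsqrt) (auto intro: infsum_nonneg)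
qed

lemma ell2_norm_nonneg: "0 \<le> ell2_norm S \<psi>"
  by (simp add: ell2_norm_def infsum_nonneg)

lemma cmod_le_ell2_norm:
  assumes "\<psi> \<in> ell2 S"
  shows "cmod (\<psi> v) \<le> ell2_norm S \<psi>"
proof (cases "v \<in> S")
  case True
  then show ?thesis using L2_set_le_ell2_norm[OF assms, of "{v}"] by simp
next
  case False
  then show ?thesis using assms ell2_norm_nonneg by (simp add: ell2_def)
qed

lemma L2_set_sum_le:
  fixes g :: "nat \<Rightarrow> 'a \<Rightarrow> complex"
  shows "L2_set (\<lambda>v. cmod (\<Sum>n<N. g n v)) F \<le> (\<Sum>n<N. L2_set (\<lambda>v. cmod (g n v)) F)"
proof (induction N)
  case (Suc N)
  have "L2_set (\<lambda>v. cmod (\<Sum>n<Suc N. g n v)) F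
      \<le> L2_set (\<lambda>v. cmod (\<Sum>n<N. g n v) + cmod (g N v)) F"
    by (rule L2_set_mono) (auto intro: norm_triangle_ineq)
  also have "\<dots> \<le> L2_set (\<lambda>v. cmod (\<Sum>n<N. g n v)) F + L2_set (\<lambda>v. cmod (g N v)) F"
    by (rule L2_set_triangle_ineq)
  finally show ?case using Suc by simp
qed (simp add: L2_set_def)

section \<open>Adjacency operators: linearity, Schur's test and the resolvent\<close>

lemma adjacency_op_outside: "v \<notin> verts G \<Longrightarrow> adjacency_op G \<psi> v = 0"
  by (simp add: adjacency_op_def schroedinger_op_def)

lemma adjacency_op_linear:
  "adjacency_op G (\<lambda>v. \<phi> v + \<psi> v) = (\<lambda>v. adjacency_op G \<phi> v + adjacency_op G \<psi> v)"
  "adjacency_op G (\<lambda>v. a * \<psi> v) = (\<lambda>v. a * adjacency_op G \<psi> v)"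
proof -
  show "adjacency_op G (\<lambda>v. \<phi> v + \<psi> v) = (\<lambda>v. adjacency_op G \<phi> v + adjacency_op G \<psi> v)"
  proof
    fix v show "adjacency_op G (\<lambda>v. \<phi> v + \<psi> v) v = adjacency_op G \<phi> v + adjacency_op G \<psi> v"
      by (cases "v \<in> verts G")
        (simp_all add: adjacency_op_eq adjacency_op_outside sum.distrib)
  qed
  show "adjacency_op G (\<lambda>v. a * \<psi> v) = (\<lambda>v. a * adjacency_op G \<psi> v)"
  proof
    fix v show "adjacency_op G (\<lambda>v. a * \<psi> v) v = a * adjacency_op G \<psi> v"
      by (cases "v \<in> verts G")
        (simp_all add: adjacency_op_eq adjacency_op_outside sum_distrib_left)
  qed
qed

lemma adjacency_power_linear:
  "(adjacency_op G ^^ n) (\<lambda>v. \<phi> v + \<psi> v) = (\<lambda>v. (adjacency_op G ^^ n) \<phi> v + (adjacency_op G ^^ n) \<psi> v)"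
  "(adjacency_op G ^^ n) (\<lambda>v. a * \<psi> v) = (\<lambda>v. a * (adjacency_op G ^^ n) \<psi> v)"
  by (induction n) (simp_all add: adjacency_op_linear)

lemma nbrs_sym: "is_graph G \<Longrightarrow> u \<in> nbrs G v \<longleftrightarrow> v \<in> nbrs G u"
  unfolding is_graph_def nbrs_def by (auto dest: symD)

lemma nbrs_subset_verts: "is_graph G \<Longrightarrow> nbrs G v \<subseteq> verts G"
  unfolding is_graph_def nbrs_def by auto

text \<open>Schur's test: Cauchy-Schwarz with the weights \<open>w\<close>.\<close>

lemma L2_set_adjacency_le:
  assumes graph: "is_graph G" and fin: "\<And>v. v \<in> verts G \<Longrightarrow> finite (nbrs G v)"
    and w: "\<And>v. v \<in> verts G \<Longrightarrow> w v > 0"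
    and super: "\<And>v. v \<in> verts G \<Longrightarrow> (\<Sum>u\<in>nbrs G v. w u) \<le> c * w v"
    and c: "0 \<le> c" and \<psi>: "\<psi> \<in> ell2 (verts G)"
    and F: "finite F" "F \<subseteq> verts G"
  shows "L2_set (\<lambda>v. cmod (adjacency_op G \<psi> v)) F \<le> c * ell2_norm (verts G) \<psi>"
proof -
  \<comment> \<open>All neighbours of \<open>F\<close> lie in this finite set, so the double sum
    below is finite and its order may be exchanged.\<close>
  define U where "U = (\<Union>v\<in>F. nbrs G v)"
  have U: "finite U" "U \<subseteq> verts G"
    using F fin nbrs_subset_verts[OF graph] by (auto simp: U_def)
  define q where "q u = (cmod (\<psi> u))\<^sup>2 / w u" for u
  have q: "0 \<le> q u" if "u \<in> verts G" for u
    using w[OF that] by (simp add: q_def)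
  have step: "(cmod (adjacency_op G \<psi> v))\<^sup>2 \<le> c * w v * (\<Sum>u\<in>nbrs G v. q u)"
    if v: "v \<in> verts G" for v
  proof -
    have wn: "w u > 0" if "u \<in> nbrs G v" for u
      using that w nbrs_subset_verts[OF graph] by blast
    have "(cmod (adjacency_op G \<psi> v))\<^sup>2 \<le> (\<Sum>u\<in>nbrs G v. cmod (\<psi> u))\<^sup>2"
      using v by (intro power_mono) (simp_all add: adjacency_op_eq norm_sum)
    also have "\<dots> = (\<Sum>u\<in>nbrs G v. sqrt (w u) * (cmod (\<psi> u) / sqrt (w u)))\<^sup>2"
      by (intro arg_cong[where f = "\<lambda>x. x\<^sup>2"] sum.cong) (auto dest: wn)
    also have "\<dots> \<le> (\<Sum>u\<in>nbrs G v. (sqrt (w u))\<^sup>2) * (\<Sum>u\<in>nbrs G v. (cmod (\<psi> u) / sqrt (w u))\<^sup>2)"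
      by (rule Cauchy_Schwarz_ineq_sum)
    also have "\<dots> = (\<Sum>u\<in>nbrs G v. w u) * (\<Sum>u\<in>nbrs G v. q u)"
      by (intro arg_cong2[where f = "(*)"] sum.cong)
        (auto simp: q_def power_divide real_sqrt_pow2 less_imp_le dest!: wn)
    also have "\<dots> \<le> c * w v * (\<Sum>u\<in>nbrs G v. q u)"
      using super[OF v] nbrs_subset_verts[OF graph] q by (intro mult_right_mono sum_nonneg) auto
    finally show ?thesis .
  qed
  have "(\<Sum>v\<in>F. (cmod (adjacency_op G \<psi> v))\<^sup>2) \<le> (\<Sum>v\<in>F. c * w v * (\<Sum>u\<in>nbrs G v. q u))"
    using F step by (intro sum_mono) auto
  also have "\<dots> = (\<Sum>v\<in>F. \<Sum>u | u \<in> U \<and> u \<in> nbrs G v. c * w v * q u)"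
    by (auto simp: sum_distrib_left U_def intro!: sum.cong)
  \<comment> \<open>After the exchange, the weights \<open>w v\<close> are summed over neighbours
    \<open>v\<close> of a fixed \<open>u\<close>. Thus \<open>super\<close> applies a second time
    and supplies the other factor \<open>c\<close>.\<close>
  also have "\<dots> = (\<Sum>u\<in>U. \<Sum>v | v \<in> F \<and> u \<in> nbrs G v. c * w v * q u)"
    by (rule sum.swap_restrict[OF F(1) U(1)])
  also have "\<dots> \<le> (\<Sum>u\<in>U. c\<^sup>2 * (cmod (\<psi> u))\<^sup>2)"
  proof (rule sum_mono)
    fix u assume "u \<in> U"
    then have u: "u \<in> verts G" using U by blast
    have sub: "{v. v \<in> F \<and> u \<in> nbrs G v} \<subseteq> nbrs G u"
      using nbrs_sym[OF graph] by blast
    have "(\<Sum>v | v \<in> F \<and> u \<in> nbrs G v. w v) \<le> (\<Sum>v\<in>nbrs G u. w v)"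
    proof (rule sum_mono2[OF fin[OF u] sub])
      show "0 \<le> w v" if "v \<in> nbrs G u - {v. v \<in> F \<and> u \<in> nbrs G v}" for v
        using that nbrs_subset_verts[OF graph] w by (blast intro: less_imp_le)
    qed
    also have "\<dots> \<le> c * w u" by (rule super[OF u])
    finally have "c * q u * (\<Sum>v | v \<in> F \<and> u \<in> nbrs G v. w v) \<le> c * q u * (c * w u)"
      using c q[OF u] by (intro mult_left_mono) auto
    also have "\<dots> = c\<^sup>2 * (cmod (\<psi> u))\<^sup>2"
      using w[OF u] by (simp add: q_def power2_eq_square)
    finally show "(\<Sum>v | v \<in> F \<and> u \<in> nbrs G v. c * w v * q u) \<le> c\<^sup>2 * (cmod (\<psi> u))\<^sup>2"
      by (simp add: sum_distrib_left mult_ac)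
  qed
  also have "\<dots> = (c * L2_set (\<lambda>u. cmod (\<psi> u)) U)\<^sup>2"
    by (simp add: L2_set_def power_mult_distrib sum_nonneg sum_distrib_left)
  finally have "L2_set (\<lambda>v. cmod (adjacency_op G \<psi> v)) F \<le> c * L2_set (\<lambda>u. cmod (\<psi> u)) U"
    using c unfolding L2_set_def by (intro real_le_lsqrt) (auto simp: sum_nonneg)
  also have "\<dots> \<le> c * ell2_norm (verts G) \<psi>"
    using c L2_set_le_ell2_norm[OF \<psi> U] by (intro mult_left_mono)
  finally show ?thesis .
qed

text \<open>Schur's test bounds the operator norm by \<open>c\<close>, so for
  \<open>cmod z > c\<close> the Neumann series inverts the shifted operator. The series is summed
  vertex by vertex, and its norm is controlled afterwards.\<close>

lemma schur_test_resolvent: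
  assumes graph: "is_graph G" and fin: "\<And>v. v \<in> verts G \<Longrightarrow> finite (nbrs G v)"
    and w: "\<And>v. v \<in> verts G \<Longrightarrow> w v > 0"
    and super: "\<And>v. v \<in> verts G \<Longrightarrow> (\<Sum>u\<in>nbrs G v. w u) \<le> c * w v"
    and c: "0 \<le> c" and z: "c < cmod z"
  shows "z \<in> resolvent_set (verts G) (adjacency_op G)"
proof -
  let ?A = "adjacency_op G" and ?V = "verts G"
  let ?N = "ell2_norm ?V"
  have z0: "z \<noteq> 0" using c z by auto
  have A: "?A \<psi> \<in> ell2 ?V" "?N (?A \<psi>) \<le> c * ?N \<psi>" if "\<psi> \<in> ell2 ?V" for \<psi>
    by (rule ell2_boundI[OF adjacency_op_outside L2_set_adjacency_le[OF graph fin w super c that]];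
        assumption)+
  have An: "(?A ^^ n) \<psi> \<in> ell2 ?V \<and> ?N ((?A ^^ n) \<psi>) \<le> c ^ n * ?N \<psi>"
    if "\<psi> \<in> ell2 ?V" for \<psi> n
  proof (induction n)
    case (Suc n)
    have "?N (?A ((?A ^^ n) \<psi>)) \<le> c * ?N ((?A ^^ n) \<psi>)" using A Suc by blast
    also have "\<dots> \<le> c * (c ^ n * ?N \<psi>)" using Suc c by (intro mult_left_mono) auto
    finally show ?case using A Suc by (simp add: mult.assoc)
  qed (simp add: that)
  \<comment> \<open>Terms of the Neumann series: the inverse of \<open>A - z\<close> is minus the
    sum of \<open>A ^ n / z ^ (n + 1)\<close>. The numbers \<open>b n\<close> below bound the norms
    of these terms and form a geometric series.\<close>
  define g where "g \<psi> n v = (?A ^^ n) \<psi> v / z ^ Suc n" for \<psi> n v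
  define b where "b n = c ^ n / cmod z ^ Suc n" for n
  have b: "b sums (1 / (cmod z - c))"
  proof -
    have "(\<lambda>n. (c / cmod z) ^ n) sums (1 / (1 - c / cmod z))"
      using c z z0 by (intro geometric_sums) (simp add: norm_divide)
    then have "(\<lambda>n. 1 / cmod z * (c / cmod z) ^ n) sums (1 / cmod z * (1 / (1 - c / cmod z)))"
      by (rule sums_mult)
    moreover have "1 / cmod z * (1 / (1 - c / cmod z)) = 1 / (cmod z - c)"
      using z0 z by (simp add: field_simps)
    ultimately show ?thesis
      by (simp add: b_def[abs_def] power_divide)
  qed
  have b_nonneg: "0 \<le> b n" for n using c by (simp add: b_def)
  have g_le: "cmod (g \<psi> n v) \<le> b n * ?N \<psi>" if "\<psi> \<in> ell2 ?V" for \<psi> n v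
  proof -
    have "cmod ((?A ^^ n) \<psi> v) \<le> c ^ n * ?N \<psi>"
      using An[OF that, of n] cmod_le_ell2_norm[of "(?A ^^ n) \<psi>" ?V v] by linarith
    then show ?thesis
      by (simp add: g_def b_def norm_divide norm_mult norm_power divide_right_mono)
  qed
  have sg: "summable (\<lambda>n. g \<psi> n v)" if "\<psi> \<in> ell2 ?V" for \<psi> v
    by (rule summable_comparison_test'[OF summable_mult2[OF sums_summable[OF b]]])
      (rule g_le[OF that])
  define R where "R \<psi> v = - (\<Sum>n. g \<psi> n v)" for \<psi> v
  have R: "R \<psi> \<in> ell2 ?V" "?N (R \<psi>) \<le> 1 / (cmod z - c) * ?N \<psi>" if \<psi>: "\<psi> \<in> ell2 ?V" for \<psi>
  proof -
    have "R \<psi> v = 0" if "v \<notin> ?V" for v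
    proof -
      have "(?A ^^ n) \<psi> v = 0" for n
        using An[OF \<psi>, of n] that by (simp add: ell2_def)
      then show ?thesis by (simp add: R_def g_def)
    qed
    moreover have "L2_set (\<lambda>v. cmod (R \<psi> v)) F \<le> 1 / (cmod z - c) * ?N \<psi>"
      if F: "finite F" "F \<subseteq> ?V" for F
    \<comment> \<open>The pointwise limit passes through \<open>L2_set\<close> because
      \<open>F\<close> is finite, so a bound uniform in the number of terms survives.\<close>
    proof (rule LIMSEQ_le_const2)
      show "(\<lambda>N. L2_set (\<lambda>v. cmod (\<Sum>n<N. g \<psi> n v)) F) \<longlonglongrightarrow> L2_set (\<lambda>v. cmod (R \<psi> v)) F"
        unfolding L2_set_def R_def norm_minus_cancel
        by (intro tendsto_real_sqrt tendsto_sum tendsto_power tendsto_norm summable_LIMSEQ sg \<psi>)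
      have "L2_set (\<lambda>v. cmod (\<Sum>n<N. g \<psi> n v)) F \<le> 1 / (cmod z - c) * ?N \<psi>" for N
      proof -
        have "L2_set (\<lambda>v. cmod (g \<psi> n v)) F \<le> b n * ?N \<psi>" for n
        proof -
          have "L2_set (\<lambda>v. cmod (g \<psi> n v)) F
              = L2_set (\<lambda>v. inverse (cmod z ^ Suc n) * cmod ((?A ^^ n) \<psi> v)) F"
            by (simp add: g_def norm_mult norm_power norm_inverse divide_inverse mult.commute)
          also have "\<dots> = inverse (cmod z ^ Suc n) * L2_set (\<lambda>v. cmod ((?A ^^ n) \<psi> v)) F"
            by (rule L2_set_right_distrib[symmetric]) simp
          also have "\<dots> \<le> inverse (cmod z ^ Suc n) * (c ^ n * ?N \<psi>)"
            using An[OF \<psi>, of n] L2_set_le_ell2_norm[OF _ F, of "(?A ^^ n) \<psi>"]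
            by (intro mult_left_mono) auto
          finally show ?thesis by (simp add: b_def divide_inverse mult_ac)
        qed
        then have "L2_set (\<lambda>v. cmod (\<Sum>n<N. g \<psi> n v)) F \<le> (\<Sum>n<N. b n * ?N \<psi>)"
          by (intro order_trans[OF L2_set_sum_le] sum_mono)
        also have "\<dots> = (\<Sum>n<N. b n) * ?N \<psi>" by (simp add: sum_distrib_right)
        also have "\<dots> \<le> 1 / (cmod z - c) * ?N \<psi>"
          using sum_le_suminf[OF sums_summable[OF b], of "{..<N}"] sums_unique[OF b] b_nonneg
          by (intro mult_right_mono ell2_norm_nonneg) auto
        finally show ?thesis .
      qed
      then show "\<exists>M. \<forall>N\<ge>M. L2_set (\<lambda>v. cmod (\<Sum>n<N. g \<psi> n v)) F \<le> 1 / (cmod z - c) * ?N \<psi>"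
        by blast
    qed
    ultimately show "R \<psi> \<in> ell2 ?V" "?N (R \<psi>) \<le> 1 / (cmod z - c) * ?N \<psi>"
      by (fact ell2_boundI[of ?V "R \<psi>"])+
  qed
  have "bounded_operator ?V R"
    unfolding bounded_operator_def
  proof (intro conjI ballI allI exI)
    fix \<phi> \<psi> a assume \<phi>: "\<phi> \<in> ell2 ?V" and \<psi>: "\<psi> \<in> ell2 ?V"
    have "g (\<lambda>v. \<phi> v + \<psi> v) n v = g \<phi> n v + g \<psi> n v" for n v
      by (simp add: g_def adjacency_power_linear add_divide_distrib)
    then show "R (\<lambda>v. \<phi> v + \<psi> v) = (\<lambda>v. R \<phi> v + R \<psi> v)"
      by (simp add: R_def fun_eq_iff suminf_add[OF sg[OF \<phi>] sg[OF \<psi>], symmetric])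
  next
    fix \<psi> a assume \<psi>: "\<psi> \<in> ell2 ?V"
    have "g (\<lambda>v. a * \<psi> v) n v = a * g \<psi> n v" for n v
      by (simp add: g_def adjacency_power_linear)
    then show "R (\<lambda>v. a * \<psi> v) = (\<lambda>v. a * R \<psi> v)"
      by (simp add: R_def fun_eq_iff suminf_mult[OF sg[OF \<psi>]])
  qed (use R in blast)+
  moreover have "R (shifted ?A z \<psi>) = \<psi> \<and> shifted ?A z (R \<psi>) = \<psi>" if \<psi>: "\<psi> \<in> ell2 ?V" for \<psi>
  proof -
    define s where "s v = (\<Sum>n. g \<psi> n v)" for v
    \<comment> \<open>Applying \<open>A\<close> to the term of index \<open>n\<close> gives
      \<open>z\<close> times the term of index \<open>n + 1\<close>. Both composites with
      \<open>R\<close> therefore telescope, and only the initial term, \<open>\<psi> v / z\<close>,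
      remains.\<close>
    have tele: "(\<lambda>n. z * g \<psi> (Suc n) v) sums (z * s v - \<psi> v)" for v
    proof -
      have "(\<lambda>n. g \<psi> n v) sums s v" unfolding s_def by (rule summable_sums[OF sg[OF \<psi>]])
      then have "(\<lambda>n. g \<psi> (Suc n) v) sums (s v - g \<psi> 0 v)"
        by (subst sums_Suc_iff) simp
      then have "(\<lambda>n. z * g \<psi> (Suc n) v) sums (z * (s v - g \<psi> 0 v))"
        by (rule sums_mult)
      moreover have "z * (s v - g \<psi> 0 v) = z * s v - \<psi> v"
        using z0 by (simp add: g_def right_diff_distrib)
      ultimately show ?thesis by simp
    qed
    have "R (shifted ?A z \<psi>) v = \<psi> v" for v
    proof -
      have "shifted ?A z \<psi> = (\<lambda>v. ?A \<psi> v + (- z) * \<psi> v)"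
        by (simp add: shifted_def)
      then have "(?A ^^ n) (shifted ?A z \<psi>) = (\<lambda>v. (?A ^^ Suc n) \<psi> v + (- z) * (?A ^^ n) \<psi> v)" for n
        by (simp only: adjacency_power_linear funpow_Suc_right o_def)
      then have "g (shifted ?A z \<psi>) n v = z * g \<psi> (Suc n) v - z * g \<psi> n v" for n
        using z0 by (simp add: g_def field_simps)
      moreover have "(\<lambda>n. z * g \<psi> (Suc n) v - z * g \<psi> n v) sums (z * s v - \<psi> v - z * s v)"
        by (intro sums_diff tele sums_mult) (simp add: s_def summable_sums[OF sg[OF \<psi>]])
      ultimately have "(\<lambda>n. g (shifted ?A z \<psi>) n v) sums (- \<psi> v)" by simp
      then show ?thesis by (simp add: R_def sums_unique[symmetric])
    qed
    moreover have "shifted ?A z (R \<psi>) v = \<psi> v" for v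
    proof (cases "v \<in> ?V")
      case True
      \<comment> \<open>Neighbourhoods are finite, so \<open>A\<close> may be applied to the series
        term by term.\<close>
      have "(\<lambda>n. \<Sum>u\<in>nbrs G v. g \<psi> n u) sums (\<Sum>u\<in>nbrs G v. s u)"
        unfolding s_def by (intro sums_sum summable_sums sg \<psi>)
      moreover have "(\<Sum>u\<in>nbrs G v. g \<psi> n u) = z * g \<psi> (Suc n) v" for n
        using True z0 by (simp add: g_def adjacency_op_eq flip: sum_divide_distrib)
      ultimately have "(\<Sum>u\<in>nbrs G v. s u) = z * s v - \<psi> v"
        using tele[of v] by (simp add: sums_unique2)
      then show ?thesis
        using True by (simp add: shifted_def adjacency_op_eq R_def s_def sum_negf)
    next
      case False
      then show ?thesis
        using \<psi> R(1)[OF \<psi>] by (simp add: shifted_def adjacency_op_outside ell2_def)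
    qed
    ultimately show ?thesis by blast
  qed
  ultimately show ?thesis unfolding resolvent_set_def by blast
qed

section \<open>Convergence of adjacency operators from isomorphisms of balls\<close>

lemma transport_bij:
  assumes "bij_betw f A B" "a \<in> A"
  shows "transport A f \<psi> (f a) = \<psi> a"
proof -
  have "{x \<in> A. f x = f a} = {a}"
    using assms by (auto simp: bij_betw_def inj_on_def)
  then show ?thesis by (simp add: transport_def)
qed

lemma transport_inv_bij:
  assumes "bij_betw f A B" "a \<in> A"
  shows "transport B (inv_into A f) \<psi> a = \<psi> (f a)"
proof -
  have "transport B (inv_into A f) \<psi> (inv_into A f (f a)) = \<psi> (f a)"
    using assms by (intro transport_bij[OF bij_betw_inv_into]) (auto simp: bij_betw_def)
  then show ?thesis using assms by (simp add: bij_betw_inv_into_left)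
qed

lemma local_adjacency_eq:
  assumes "is_graph G" "finite (nbrs G x)" "x \<in> gball G v r"
  shows "local_op G (adjacency_op G) v r \<psi> x = (\<Sum>u | u \<in> gball G v r \<and> (u, x) \<in> edges G. \<psi> u)"
proof -
  have "local_op G (adjacency_op G) v r \<psi> x
      = (\<Sum>u\<in>nbrs G x. if u \<in> gball G v r then \<psi> u else 0)"
    using assms by (simp add: local_op_def cutoff_def adjacency_op_eq gball_def)
  also have "\<dots> = (\<Sum>u | u \<in> gball G v r \<and> (u, x) \<in> edges G. \<psi> u)"
    using assms(2) by (intro sum.mono_neutral_cong_right) (auto simp: nbrs_def)
  finally show ?thesis .
qed

text \<open>Since the adjacency operator sees only edges, condition (C2) is a consequence of (C1).\<close>

lemma local_adjacency_transport:
  assumes G: "is_graph G" "degree_bounded d G" and G': "is_graph G'" "degree_bounded d' G'"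
    and iso: "induced_iso G (gball G v r) G' (gball G' v' r) f"
  shows "(transport (gball G v r) f \<circ> local_op G (adjacency_op G) v r \<circ>
            transport (gball G' v' r) (inv_into (gball G v r) f)) \<psi> b
         = local_op G' (adjacency_op G') v' r \<psi> b"
proof -
  let ?A = "gball G v r" and ?B = "gball G' v' r"
  have bij: "bij_betw f ?A ?B" and
    edge: "\<And>x y. x \<in> ?A \<Longrightarrow> y \<in> ?A \<Longrightarrow> (x, y) \<in> edges G \<longleftrightarrow> (f x, f y) \<in> edges G'"
    using iso by (auto simp: induced_iso_def)
  show ?thesis
  proof (cases "b \<in> ?B")
    case True
    then obtain a where a: "a \<in> ?A" "b = f a" using bij by (auto simp: bij_betw_def)
    have fin: "finite (nbrs G a)" "finite (nbrs G' b)"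
      using a True G G' by (auto simp: degree_bounded_def gball_def)
    have img: "?B = f ` ?A" using bij by (simp add: bij_betw_def)
    have "bij_betw f {u. u \<in> ?A \<and> (u, a) \<in> edges G} {u. u \<in> ?B \<and> (u, b) \<in> edges G'}"
    proof (rule bij_betw_subset[OF bij])
      show "f ` {u. u \<in> ?A \<and> (u, a) \<in> edges G} = {u. u \<in> ?B \<and> (u, b) \<in> edges G'}"
        unfolding img a(2) using edge[OF _ a(1)] by auto
    qed auto
    then have "(\<Sum>u | u \<in> ?A \<and> (u, a) \<in> edges G. \<psi> (f u))
        = (\<Sum>u | u \<in> ?B \<and> (u, b) \<in> edges G'. \<psi> u)"
      by (rule sum.reindex_bij_betw)
    then have "(\<Sum>u | u \<in> ?A \<and> (u, a) \<in> edges G. transport ?B (inv_into ?A f) \<psi> u)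
        = (\<Sum>u | u \<in> ?B \<and> (u, b) \<in> edges G'. \<psi> u)"
      using transport_inv_bij[OF bij] by simp
    then show ?thesis
      unfolding o_def a(2) transport_bij[OF bij a(1)] local_adjacency_eq[OF G(1) fin(1) a(1)]
        local_adjacency_eq[OF G'(1) fin(2)[unfolded a(2)] True[unfolded a(2)]] .
  next
    case False
    then have "{a \<in> ?A. f a = b} = {}" using bij by (auto simp: bij_betw_def)
    then have "transport ?A f \<phi> b = 0" for \<phi>
      unfolding transport_def by (metis sum.empty)
    then show ?thesis using False by (simp add: local_op_def cutoff_def)
  qed
qed

lemma operator_norm_zero: "operator_norm S (\<lambda>\<psi> v. 0) = 0"
proof -
  \<comment> \<open>The supremum of a constant equals that constant only over a nonempty set; the
    zero function witnesses this.\<close>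
  have "(\<lambda>_. 0) \<in> {\<psi>\<in>ell2 S. ell2_norm S \<psi> \<le> 1}"
    by (simp add: ell2_def ell2_norm_def)
  then have ne: "{\<psi>\<in>ell2 S. ell2_norm S \<psi> \<le> 1} \<noteq> {}" by blast
  show ?thesis using ne by (simp add: operator_norm_def ell2_norm_def)
qed

text \<open>Convergence becomes purely combinatorial: once the balls are isomorphic, the operator
  difference in (C2) vanishes identically, so each sequence of norms is eventually
  \<open>0\<close>.\<close>

lemma converges_to_adjacency:
  assumes sch: "\<And>n. is_schroedinger (G n) (adjacency_op (G n))"
      "is_schroedinger G' (adjacency_op G')"
    and bounded: "\<And>n. degree_bounded d (G n)"
    and v: "\<And>n. v n \<in> verts (G n)" "v' \<in> verts G'"
    and coh: "\<And>n. coherent_maps (G n) (v n) G' v' (f n)"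
    and iso: "\<And>r. \<forall>\<^sub>F n in sequentially.
      induced_iso (G n) (gball (G n) (v n) r) G' (gball G' v' r) (f n r)"
  shows "converges_to (\<lambda>n. adjacency_op (G n)) G v (adjacency_op G') G' v'"
proof -
  obtain d' where d': "degree_bounded d' G'" using sch(2) by (auto simp: is_schroedinger_def)
  have gr: "is_graph (G n)" "is_graph G'" for n using sch by (auto simp: is_schroedinger_def)
  have "(\<lambda>n. operator_norm (gball G' v' r)
      (\<lambda>\<psi> b. (transport (gball (G n) (v n) r) (f n r) \<circ>
         local_op (G n) (adjacency_op (G n)) (v n) r \<circ>
         transport (gball G' v' r) (inv_into (gball (G n) (v n) r) (f n r))) \<psi> b
         - local_op G' (adjacency_op G') v' r \<psi> b)) \<longlonglongrightarrow> 0" for r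
    using iso[of r]
    by (intro tendsto_eventually, elim eventually_mono)
      (simp only: local_adjacency_transport[OF gr(1) bounded gr(2) d']
        diff_self operator_norm_zero)
  then show ?thesis
    unfolding converges_to_def
    using sch bounded v coh iso[unfolded eventually_sequentially] by blast
qed

section \<open>Distances through walks, and trees on subsets of \<int> \<times> \<nat>\<close>

lemma gdist_le: "(u, v) \<in> edges G ^^ n \<Longrightarrow> gdist G u v \<le> n"
  unfolding gdist_def by (rule Least_le)

lemma gdist_walk:
  assumes "connected_graph G" "u \<in> verts G" "v \<in> verts G"
  shows "(u, v) \<in> edges G ^^ gdist G u v"
proof -
  have "\<exists>n. (u, v) \<in> edges G ^^ n"
    using assms by (auto simp: connected_graph_def dest: rtrancl_imp_relpow)
  then show ?thesis unfolding gdist_def by (rule LeastI_ex)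
qed

text \<open>\<open>gdist\<close> is measured towards the centre. Symmetry of the edges reverses the
  walks, so that balls can be explored by induction on walks starting at the centre.\<close>

lemma mem_gball_iff:
  assumes "is_graph G" "connected_graph G" "v \<in> verts G"
  shows "u \<in> gball G v r \<longleftrightarrow> u \<in> verts G \<and> (\<exists>j\<le>r. (v, u) \<in> edges G ^^ j)"
proof -
  have "sym (edges G)" using assms(1) by (simp add: is_graph_def)
  then have "(y, x) \<in> edges G ^^ j" if "(x, y) \<in> edges G ^^ j" for x y j
    using that
  proof (induction j arbitrary: y)
    case (Suc j)
    then obtain w where "(w, x) \<in> edges G ^^ j" "(w, y) \<in> edges G" by auto
    with \<open>sym (edges G)\<close> show ?case by (blast intro: relpow_Suc_I2 dest: symD)
  qed simp
  then have "(v, u) \<in> edges G ^^ j \<longleftrightarrow> (u, v) \<in> edges G ^^ j" for j by blast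
  then show ?thesis
    using gdist_walk[OF assms(2) _ assms(3)] gdist_le[of u v _ G]
    by (fastforce simp: gball_def)
qed

text \<open>The map \<open>parent\<close> turns \<open>\<int> \<times> \<nat>\<close> into the 3-regular tree: the end fixed by the height
  function \<open>fst\<close> is reached from every vertex because repeated halving ends in \<open>0\<close>.\<close>

definition parent :: "int \<times> nat \<Rightarrow> int \<times> nat" where
  "parent a = (fst a + 1, snd a div 2)"

text \<open>Pairs are coded by \<open>to_nat\<close> so that all graphs have natural numbers as
  vertices. The parameter \<open>S\<close> covers the full tree and its subtree at once, so degree
  and spectral bounds are proved once for both.\<close>

definition tree_on :: "(int \<times> nat) set \<Rightarrow> nat ugraph" where
  "tree_on S = \<lparr>verts = to_nat ` S,
     edges = {(to_nat a, to_nat b) | a b. a \<in> S \<and> b \<in> S \<and> (b = parent a \<or> a = parent b)}\<rparr>"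

lemma verts_tree_on [simp]: "verts (tree_on S) = to_nat ` S"
  by (simp add: tree_on_def)

lemma edges_tree_on:
  "(to_nat a, to_nat b) \<in> edges (tree_on S) \<longleftrightarrow> a \<in> S \<and> b \<in> S \<and> (b = parent a \<or> a = parent b)"
  by (auto simp: tree_on_def simp del: split_paired_Ex)

lemma edges_tree_onE:
  assumes "(u, v) \<in> edges (tree_on S)"
  obtains a b where "u = to_nat a" "v = to_nat b" "a \<in> S" "b \<in> S" "b = parent a \<or> a = parent b"
  using assms by (auto simp: tree_on_def)

lemma is_graph_tree_on: "is_graph (tree_on S)"
  unfolding is_graph_def
proof (intro conjI)
  show "edges (tree_on S) \<subseteq> verts (tree_on S) \<times> verts (tree_on S)"
    by (auto elim!: edges_tree_onE)
  show "sym (edges (tree_on S))"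
    by (rule symI) (auto elim!: edges_tree_onE simp: edges_tree_on)
  show "irrefl (edges (tree_on S))"
    by (rule irreflI) (auto elim!: edges_tree_onE simp: parent_def prod_eq_iff)
qed auto

text \<open>The two vertices below \<open>a\<close> come from the two preimages of
  \<open>snd a\<close> under halving.\<close>

lemma nbrs_tree_on:
  assumes "a \<in> S"
  shows "nbrs (tree_on S) (to_nat a) =
    to_nat ` (S \<inter> {parent a, (fst a - 1, 2 * snd a), (fst a - 1, 2 * snd a + 1)})"
proof -
  have children: "a = parent b \<longleftrightarrow> b \<in> {(fst a - 1, 2 * snd a), (fst a - 1, 2 * snd a + 1)}" for b
  proof -
    have "snd a = snd b div 2 \<longleftrightarrow> snd b = 2 * snd a \<or> snd b = 2 * snd a + 1" by presburger
    then show ?thesis by (auto simp: parent_def prod_eq_iff)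
  qed
  show ?thesis
  proof (rule set_eqI)
    fix u
    show "u \<in> nbrs (tree_on S) (to_nat a) \<longleftrightarrow>
      u \<in> to_nat ` (S \<inter> {parent a, (fst a - 1, 2 * snd a), (fst a - 1, 2 * snd a + 1)})"
      using assms children by (auto simp: nbrs_def edges_tree_on elim!: edges_tree_onE)
  qed
qed

lemma degree_bounded_tree_on: "degree_bounded 3 (tree_on S)"
  unfolding degree_bounded_def
proof (intro ballI conjI)
  fix v assume "v \<in> verts (tree_on S)"
  then obtain a where a: "a \<in> S" "v = to_nat a" by auto
  let ?N = "{parent a, (fst a - 1, 2 * snd a), (fst a - 1, 2 * snd a + 1)}"
  show "finite (nbrs (tree_on S) v)" by (simp add: a nbrs_tree_on)
  have "deg (tree_on S) v \<le> card (S \<inter> ?N)"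
    by (simp add: deg_def a nbrs_tree_on card_image_le)
  also have "\<dots> \<le> card ?N" by (intro card_mono) auto
  also have "\<dots> \<le> 3" by (simp add: card_insert_if)
  finally show "deg (tree_on S) v \<le> 3" .
qed

text \<open>The ancestor lines of any two vertices merge: repeated halving sends both indices to
  \<open>0\<close>, and then equal heights mean equal vertices.\<close>

lemma connected_tree_on:
  assumes closed: "\<And>a. a \<in> S \<Longrightarrow> parent a \<in> S"
  shows "connected_graph (tree_on S)"
proof -
  let ?E = "edges (tree_on S)"
  have sym: "sym (?E\<^sup>*)"
    using is_graph_tree_on by (intro sym_rtrancl) (auto simp: is_graph_def)
  have up: "a \<in> S \<Longrightarrow> (parent ^^ k) a \<in> S \<and> (to_nat a, to_nat ((parent ^^ k) a)) \<in> ?E\<^sup>*" for a k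
  proof (induction k)
    case (Suc k)
    then have "(to_nat ((parent ^^ k) a), to_nat ((parent ^^ Suc k) a)) \<in> ?E"
      using closed by (simp add: edges_tree_on)
    then show ?case using Suc closed by (auto intro: rtrancl_into_rtrancl)
  qed simp
  have pow: "(parent ^^ k) a = (fst a + int k, snd a div 2 ^ k)" for a k
    by (induction k) (auto simp: parent_def div_mult2_eq mult.commute[of 2])
  show ?thesis unfolding connected_graph_def
  proof (intro ballI)
    fix u v assume "u \<in> verts (tree_on S)" "v \<in> verts (tree_on S)"
    then obtain a b where ab: "a \<in> S" "u = to_nat a" "b \<in> S" "v = to_nat b" by auto
    \<comment> \<open>Climbing to height \<open>H\<close> takes at least
      \<open>max (snd a) (snd b)\<close> steps from either vertex. As \<open>m < 2 ^ m\<close>, that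
      many halvings bring each index to \<open>0\<close>.\<close>
    define H where "H = max (fst a) (fst b) + int (max (snd a) (snd b))"
    have meet: "(parent ^^ nat (H - fst c)) c = (H, 0)"
      if "fst c \<le> max (fst a) (fst b)" "snd c \<le> max (snd a) (snd b)" for c
    proof -
      have "snd c \<le> nat (H - fst c)" using that unfolding H_def by linarith
      also have "\<dots> < 2 ^ nat (H - fst c)" by (rule less_exp)
      finally show ?thesis using that by (simp add: pow H_def)
    qed
    have "(u, to_nat (H, 0::nat)) \<in> ?E\<^sup>*" "(v, to_nat (H, 0::nat)) \<in> ?E\<^sup>*"
      using up[OF ab(1), of "nat (H - fst a)"] up[OF ab(3), of "nat (H - fst b)"]
        meet[of a] meet[of b] ab by auto
    then show "(u, v) \<in> ?E\<^sup>*"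
      using sym by (meson symD rtrancl_trans)
  qed
qed

lemma schroedinger_tree_on:
  assumes "\<And>a. a \<in> S \<Longrightarrow> parent a \<in> S"
  shows "is_schroedinger (tree_on S) (adjacency_op (tree_on S))"
proof -
  have "bounded ((\<lambda>v. real (deg (tree_on S) v)) ` verts (tree_on S))"
    using degree_bounded_tree_on[of S]
    by (intro boundedI[of _ 3]) (auto simp: degree_bounded_def)
  then show ?thesis
    unfolding is_schroedinger_def adjacency_op_def
    using is_graph_tree_on connected_tree_on[OF assms] degree_bounded_tree_on by blast
qed

section \<open>The value 3: in the resolvent set, yet with a bounded eigenfunction\<close>

lemma three_in_resolvent_tree_on:
  "3 \<in> resolvent_set (verts (tree_on S)) (adjacency_op (tree_on S))"
proof (rule schur_test_resolvent)
  \<comment> \<open>The parent contributes the factor \<open>3/2\<close> and each of the at most two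
    children \<open>2/3\<close>, in total \<open>3/2 + 4/3 = 17/6 < 3\<close>. Neighbours missing
    from \<open>S\<close> only lower the sum.\<close>
  define w where "w v = (3/2 :: real) powi (fst (from_nat v :: int \<times> nat))" for v
  show "0 < w v" for v by (simp add: w_def)
  show "(\<Sum>u\<in>nbrs (tree_on S) v. w u) \<le> 17/6 * w v" if v: "v \<in> verts (tree_on S)" for v
  proof -
    obtain a where a: "a \<in> S" "v = to_nat a" using v by auto
    let ?N = "{parent a, (fst a - 1, 2 * snd a), (fst a - 1, 2 * snd a + 1)}"
    have "(\<Sum>u\<in>nbrs (tree_on S) v. w u) = (\<Sum>b\<in>S \<inter> ?N. w (to_nat b))"
      unfolding a(2) nbrs_tree_on[OF a(1)] by (subst sum.reindex) auto
    also have "\<dots> \<le> (\<Sum>b\<in>?N. w (to_nat b))"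
      by (intro sum_mono2) (auto simp: w_def)
    also have "\<dots> = 17/6 * w v"
      by (simp add: a w_def parent_def power_int_add power_int_diff)
    finally show ?thesis .
  qed
qed (use degree_bounded_tree_on is_graph_tree_on in \<open>auto simp: degree_bounded_def\<close>)

text \<open>In the full tree every vertex has exactly three neighbours, so the constant function
  \<open>1\<close> serves.\<close>

lemma three_in_sigma_infty_tree:
  "3 \<in> sigma_infty (tree_on UNIV) (adjacency_op (tree_on UNIV))"
proof -
  have "adjacency_op (tree_on UNIV) (\<lambda>_. 1) v = 3" if v: "v \<in> verts (tree_on UNIV)" for v
  proof -
    obtain a :: "int \<times> nat" where a: "v = to_nat a" using v by auto
    let ?N = "{parent a, (fst a - 1, 2 * snd a), (fst a - 1, 2 * snd a + 1)}"
    have "card (nbrs (tree_on UNIV) v) = card ?N"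
      by (simp only: a nbrs_tree_on UNIV_I Int_UNIV_left card_image inj_on_subset[OF inj_to_nat] subset_UNIV)
    also have "\<dots> = 3" by (simp add: parent_def)
    finally show ?thesis using v by (simp only: adjacency_op_eq) simp
  qed
  then show ?thesis
    unfolding sigma_infty_def generalized_eigenfunction_def
    by (auto intro!: exI[of _ "\<lambda>_. 1"] simp: image_constant_conv)
qed

section \<open>Walks in the trees; the wedge and its growth\<close>

lemma walk_height:
  assumes "(u, v) \<in> edges (tree_on S) ^^ n"
  shows "\<bar>fst (from_nat v :: int \<times> nat) - fst (from_nat u :: int \<times> nat)\<bar> \<le> int n"
  using assms
proof (induction n arbitrary: v)
  case (Suc n)
  then obtain w where "(u, w) \<in> edges (tree_on S) ^^ n" "(w, v) \<in> edges (tree_on S)" by auto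
  with Suc.IH[of w] show ?case by (auto elim!: edges_tree_onE simp: parent_def)
qed simp

text \<open>A step to a child takes \<open>x\<close> to at most \<open>2 * x + 1\<close>, and
  \<open>x < 2 ^ n\<close> gives \<open>2 * x + 1 < 2 ^ (n + 1)\<close>; a step to the parent halves
  \<open>x\<close>.\<close>

lemma walk_index:
  assumes "(to_nat (h :: int, 0 :: nat), v) \<in> edges (tree_on S) ^^ n"
  shows "snd (from_nat v :: int \<times> nat) < 2 ^ n"
  using assms
proof (induction n arbitrary: v)
  case (Suc n)
  then obtain w where "(to_nat (h, 0::nat), w) \<in> edges (tree_on S) ^^ n"
    "(w, v) \<in> edges (tree_on S)" by auto
  with Suc.IH[of w] show ?case by (auto elim!: edges_tree_onE simp: parent_def)
qed auto

text \<open>The condition forces \<open>h \<ge> 0\<close> and leaves \<open>h + 1\<close> vertices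
  at height \<open>h\<close>. It survives passing to parents, so the wedge is connected.\<close>

definition wedge :: "(int \<times> nat) set" where
  "wedge = {(h, x). int x \<le> h}"

lemma parent_wedge: "a \<in> wedge \<Longrightarrow> parent a \<in> wedge"
  by (auto simp: wedge_def parent_def)

lemma connected_wedge: "connected_graph (tree_on wedge)"
  by (rule connected_tree_on[OF parent_wedge])

lemma mem_gball_wedge:
  "u \<in> gball (tree_on wedge) (to_nat (int n, 0::nat)) r \<longleftrightarrow>
    u \<in> verts (tree_on wedge) \<and> (\<exists>j\<le>r. (to_nat (int n, 0::nat), u) \<in> edges (tree_on wedge) ^^ j)"
  by (rule mem_gball_iff[OF is_graph_tree_on connected_wedge]) (auto simp: wedge_def)

lemma mem_gball_tree:
  "u \<in> gball (tree_on UNIV) (to_nat (0::int, 0::nat)) r \<longleftrightarrow>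
    u \<in> verts (tree_on UNIV) \<and> (\<exists>j\<le>r. (to_nat (0::int, 0::nat), u) \<in> edges (tree_on UNIV) ^^ j)"
  by (rule mem_gball_iff[OF is_graph_tree_on connected_tree_on]) auto

text \<open>The vertices \<open>(0, 0), (1, 0), ...\<close> form a ray of successive parents; it is
  geodesic because each edge changes the height by one.\<close>

lemma gdist_wedge: "gdist (tree_on wedge) (to_nat (0::int, 0::nat)) (to_nat (int n, 0::nat)) = n"
proof (rule antisym)
  have "(to_nat (0::int, 0::nat), to_nat (int n, 0::nat)) \<in> edges (tree_on wedge) ^^ n"
  proof (induction n)
    case (Suc n)
    have "(to_nat (int n, 0::nat), to_nat (int (Suc n), 0::nat)) \<in> edges (tree_on wedge)"
      by (simp add: edges_tree_on wedge_def parent_def)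
    with Suc show ?case by auto
  qed simp
  then show "gdist (tree_on wedge) (to_nat (0::int, 0::nat)) (to_nat (int n, 0::nat)) \<le> n"
    by (rule gdist_le)
  have "(to_nat (0::int, 0::nat), to_nat (int n, 0::nat)) \<in> edges (tree_on wedge) ^^
      gdist (tree_on wedge) (to_nat (0::int, 0::nat)) (to_nat (int n, 0::nat))"
    by (rule gdist_walk[OF connected_wedge]) (auto simp: wedge_def)
  from walk_height[OF this]
  show "n \<le> gdist (tree_on wedge) (to_nat (0::int, 0::nat)) (to_nat (int n, 0::nat))" by simp
qed

lemma subexponential_wedge: "subexponential_growth (tree_on wedge) (to_nat (0::int, 0::nat))"
  unfolding subexponential_growth_def
proof (intro allI impI)
  fix \<gamma> :: real assume \<gamma>: "1 < \<gamma>"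
  let ?B = "gball (tree_on wedge) (to_nat (0::int, 0::nat))"
  have card: "card (?B r) \<le> (r + 1)\<^sup>2" for r
  proof -
    \<comment> \<open>Within distance \<open>r\<close> the height is at most \<open>r\<close>, and
      the wedge condition bounds the index by the height.\<close>
    have "?B r \<subseteq> (\<lambda>(h, x). to_nat (int h, x)) ` ({..r} \<times> {..r})"
    proof
      fix u assume u: "u \<in> ?B r"
      then obtain h x where hx: "u = to_nat (h, x)" "int x \<le> h"
        by (auto simp: gball_def wedge_def)
      obtain j where "j \<le> r" "(to_nat (0::int, 0::nat), u) \<in> edges (tree_on wedge) ^^ j"
        using u mem_gball_wedge[of u 0 r] by auto
      then have "\<bar>h\<bar> \<le> int r" using walk_height hx by fastforce
      with hx have "nat h \<le> r" "x \<le> r" "u = to_nat (int (nat h), x)" by auto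
      then show "u \<in> (\<lambda>(h, x). to_nat (int h, x)) ` ({..r} \<times> {..r})" by force
    qed
    then have "card (?B r) \<le> card ({..r} \<times> {..r})"
      by (rule surj_card_le[rotated]) simp
    then show ?thesis by (simp add: power2_eq_square)
  qed
  \<comment> \<open>Bernoulli's inequality for \<open>sqrt \<gamma>\<close> gives
    \<open>(r + 1) * m \<le> sqrt \<gamma> ^ r\<close>, where the cap at \<open>1\<close> absorbs
    the constant term. Squaring matches the quadratic ball count.\<close>
  define m where "m = min 1 (sqrt \<gamma> - 1)"
  have m: "0 < m" using \<gamma> by (simp add: m_def)
  \<comment> \<open>The factor \<open>2\<close> makes the inequality strict.\<close>
  have "real (card (?B r)) < 2 / m\<^sup>2 * \<gamma> ^ r" for r
  proof -
    have "(real r + 1) * m = m + real r * m" by (simp add: algebra_simps)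
    also have "\<dots> \<le> 1 + real r * (sqrt \<gamma> - 1)"
      by (intro add_mono mult_left_mono) (auto simp: m_def)
    also have "\<dots> \<le> (1 + (sqrt \<gamma> - 1)) ^ r"
      using \<gamma> by (intro Bernoulli_inequality) (simp add: order_trans[OF _ real_sqrt_ge_zero])
    finally have "((real r + 1) * m)\<^sup>2 \<le> (sqrt \<gamma> ^ r)\<^sup>2"
      using m by (intro power_mono) auto
    also have "(sqrt \<gamma> ^ r)\<^sup>2 = \<gamma> ^ r"
      using \<gamma> by (simp add: power_even_eq[symmetric] power_mult[symmetric] mult.commute[of r]
          real_sqrt_pow2 power_mult[of "sqrt \<gamma>" 2])
    finally have "(real r + 1)\<^sup>2 * m\<^sup>2 \<le> \<gamma> ^ r" by (simp add: power_mult_distrib)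
    moreover have "real (card (?B r)) \<le> (real r + 1)\<^sup>2"
      using of_nat_mono[OF card[of r], where 'a = real] by (simp add: add.commute)
    ultimately have "real (card (?B r)) * m\<^sup>2 \<le> \<gamma> ^ r"
      by (meson mult_right_mono order_trans zero_le_power2)
    also have "\<dots> < 2 * \<gamma> ^ r" using \<gamma> by simp
    finally show ?thesis using m by (simp add: field_simps)
  qed
  then show "\<exists>C>0. \<forall>r. real (card (?B r)) < C * \<gamma> ^ r"
    using m by (intro exI[of _ "2 / m\<^sup>2"]) auto
qed

section \<open>The full tree as an R-limit of the wedge\<close>

text \<open>On codes of pairs this is the height shift by \<open>-n\<close>, an automorphism of the
  full tree since \<open>parent\<close> commutes with height shifts. It moves \<open>(n, 0)\<close>
  to the root \<open>(0, 0)\<close>.\<close>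

definition lower :: "nat \<Rightarrow> nat \<Rightarrow> nat" where
  "lower n u = (let a = from_nat u :: int \<times> nat in to_nat (fst a - int n, snd a))"

lemma lower_to_nat [simp]: "lower n (to_nat (h :: int, x :: nat)) = to_nat (h - int n, x)"
  by (simp add: lower_def)

lemma edges_lower:
  assumes "u \<in> verts (tree_on S)" "v \<in> verts (tree_on S)"
  shows "(lower n u, lower n v) \<in> edges (tree_on UNIV) \<longleftrightarrow> (u, v) \<in> edges (tree_on S)"
  using assms by (auto simp: edges_tree_on parent_def)

lemma walk_lower:
  assumes "(u, v) \<in> edges (tree_on S) ^^ j"
  shows "(lower n u, lower n v) \<in> edges (tree_on UNIV) ^^ j"
  using assms
proof (induction j arbitrary: v)
  case (Suc j)
  then obtain w where w: "(u, w) \<in> edges (tree_on S) ^^ j" "(w, v) \<in> edges (tree_on S)" by auto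
  then have "(lower n w, lower n v) \<in> edges (tree_on UNIV)"
    using edges_lower[of w S v n] is_graph_tree_on[of S] by (auto simp: is_graph_def)
  then show ?case using Suc.IH[OF w(1)] by auto
qed simp

text \<open>A walk of length \<open>r\<close> from \<open>(n, 0)\<close> only meets vertices \<open>(h, x)\<close> with \<open>n - r \<le> h\<close> and
  \<open>x < 2 ^ r\<close>, so it stays in the wedge for large \<open>n\<close>.\<close>

lemma lift_walk:
  assumes n: "r + 2 ^ r \<le> n" and "j \<le> r"
    and "(to_nat (0::int, 0::nat), z) \<in> edges (tree_on UNIV) ^^ j"
  shows "\<exists>u\<in>verts (tree_on wedge). z = lower n u \<and>
    (to_nat (int n, 0::nat), u) \<in> edges (tree_on wedge) ^^ j"
  using assms(2-)
proof (induction j arbitrary: z)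
  case 0
  then show ?case by (auto simp: wedge_def intro!: bexI[of _ "to_nat (int n, 0::nat)"])
next
  case (Suc j)
  then obtain y where y: "(to_nat (0::int, 0::nat), y) \<in> edges (tree_on UNIV) ^^ j"
    "(y, z) \<in> edges (tree_on UNIV)" by auto
  then obtain u where u: "u \<in> verts (tree_on wedge)" "y = lower n u"
    "(to_nat (int n, 0::nat), u) \<in> edges (tree_on wedge) ^^ j"
    using Suc by (meson Suc_leD)
  obtain k x where z: "z = to_nat (k :: int, x :: nat)"
    using y(2) by (auto elim!: edges_tree_onE)
  have k: "\<bar>k\<bar> \<le> int (Suc j)" using walk_height[OF Suc.prems(2)] by (simp add: z)
  have "x < 2 ^ Suc j" using walk_index[OF Suc.prems(2)] by (simp add: z)
  also have "\<dots> \<le> 2 ^ r" using Suc.prems(1) by (intro power_increasing) auto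
  finally have "int x \<le> k + int n" using n k Suc.prems(1) by linarith
  then have v: "to_nat (k + int n, x) \<in> verts (tree_on wedge)" "z = lower n (to_nat (k + int n, x))"
    by (auto simp: wedge_def z)
  then have "(u, to_nat (k + int n, x)) \<in> edges (tree_on wedge)"
    using y(2) u edges_lower by blast
  then show ?case using u(3) v by (blast intro: relpow_Suc_I)
qed

text \<open>The shift carries walks to walks of equal length. This yields coherent maps for every
  \<open>n\<close>, as (C1) asks even before the balls become isomorphic.\<close>

lemma lower_gball_subset:
  "lower n ` gball (tree_on wedge) (to_nat (int n, 0::nat)) r
     \<subseteq> gball (tree_on UNIV) (to_nat (0::int, 0::nat)) r"
proof
  fix z assume "z \<in> lower n ` gball (tree_on wedge) (to_nat (int n, 0::nat)) r"
  then obtain u j where u: "z = lower n u" "j \<le> r"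
    "(to_nat (int n, 0::nat), u) \<in> edges (tree_on wedge) ^^ j"
    by (auto simp only: mem_gball_wedge)
  from walk_lower[OF u(3), of n] u(1,2)
  show "z \<in> gball (tree_on UNIV) (to_nat (0::int, 0::nat)) r"
    by (auto simp: mem_gball_tree lower_def Let_def)
qed

text \<open>The size of \<open>n\<close> enters through surjectivity: short walks from the root of
  the full tree must lift to walks inside the wedge.\<close>

lemma induced_iso_lower:
  assumes n: "r + 2 ^ r \<le> n"
  shows "induced_iso (tree_on wedge) (gball (tree_on wedge) (to_nat (int n, 0::nat)) r)
    (tree_on UNIV) (gball (tree_on UNIV) (to_nat (0::int, 0::nat)) r) (lower n)"
  unfolding induced_iso_def bij_betw_def
proof (intro conjI ballI)
  show "inj_on (lower n) (gball (tree_on wedge) (to_nat (int n, 0::nat)) r)"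
    by (auto simp: inj_on_def gball_def)
  show "lower n ` gball (tree_on wedge) (to_nat (int n, 0::nat)) r =
      gball (tree_on UNIV) (to_nat (0::int, 0::nat)) r"
  proof (rule antisym[OF lower_gball_subset], rule subsetI)
    fix z assume z: "z \<in> gball (tree_on UNIV) (to_nat (0::int, 0::nat)) r"
    then obtain j where j: "j \<le> r" "(to_nat (0::int, 0::nat), z) \<in> edges (tree_on UNIV) ^^ j"
      by (auto simp only: mem_gball_tree)
    then obtain u where u: "u \<in> verts (tree_on wedge)" "z = lower n u"
        "(to_nat (int n, 0::nat), u) \<in> edges (tree_on wedge) ^^ j"
      using lift_walk[OF n] by blast
    then have "u \<in> gball (tree_on wedge) (to_nat (int n, 0::nat)) r"
      using j(1) mem_gball_wedge by blast
    then show "z \<in> lower n ` gball (tree_on wedge) (to_nat (int n, 0::nat)) r" using u by blast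
  qed
  show "((u, v) \<in> edges (tree_on wedge)) = ((lower n u, lower n v) \<in> edges (tree_on UNIV))"
    if "u \<in> gball (tree_on wedge) (to_nat (int n, 0::nat)) r"
      "v \<in> gball (tree_on wedge) (to_nat (int n, 0::nat)) r" for u v
    using that edges_lower[of u wedge v n] by (simp add: gball_def)
qed

text \<open>The base points \<open>(n, 0)\<close> lie at distance exactly \<open>n\<close> from the
  root. The same map \<open>lower n\<close> is used at every radius, so coherence reduces to the
  inclusion of balls.\<close>

lemma tree_is_R_limit:
  "(tree_on UNIV, adjacency_op (tree_on UNIV))
     \<in> R_limits (tree_on wedge) (to_nat (0::int, 0::nat)) (adjacency_op (tree_on wedge))"
proof -
  have "converges_to (\<lambda>n. adjacency_op (tree_on wedge)) (\<lambda>_. tree_on wedge)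
      (\<lambda>n. to_nat (int n, 0::nat)) (adjacency_op (tree_on UNIV)) (tree_on UNIV) (to_nat (0::int, 0::nat))"
  proof (rule converges_to_adjacency[where f = "\<lambda>n r. lower n"])
    show "coherent_maps (tree_on wedge) (to_nat (int n, 0::nat)) (tree_on UNIV)
        (to_nat (0::int, 0::nat)) (\<lambda>r. lower n)" for n
      using lower_gball_subset by (simp add: coherent_maps_def)
    show "\<forall>\<^sub>F n in sequentially. induced_iso (tree_on wedge)
        (gball (tree_on wedge) (to_nat (int n, 0::nat)) r)
        (tree_on UNIV) (gball (tree_on UNIV) (to_nat (0::int, 0::nat)) r) (lower n)" for r
      using eventually_ge_at_top[of "r + 2 ^ r"] by eventually_elim (rule induced_iso_lower)
    show "to_nat (int n, 0::nat) \<in> verts (tree_on wedge)" for n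
      by (auto simp: wedge_def)
  qed (auto intro: schroedinger_tree_on parent_wedge degree_bounded_tree_on)
  moreover have "to_nat (int n, 0::nat) \<in> verts (tree_on wedge)" for n
    by (auto simp: wedge_def)
  moreover have "to_nat (0::int, 0::nat) \<in> verts (tree_on UNIV)" by simp
  ultimately show ?thesis
    unfolding R_limits_def
    by (auto simp: gdist_wedge filterlim_ident mono_def simp del: verts_tree_on
        intro!: schroedinger_tree_on
        bexI[of _ "to_nat (0::int, 0::nat)"] exI[of _ "\<lambda>n. to_nat (int n, 0::nat)"])
qed

theorem proposition2p3:
  "\<exists>(d::nat) (G :: nat ugraph) (v0::nat).
     is_graph G \<and> v0 \<in> verts G \<and> infinite (verts G) \<and> connected_graph G \<and>
     degree_bounded d G \<and> subexponential_growth G v0 \<and>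
     (\<Union>(G', H') \<in> (R_limits G v0 (adjacency_op G) :: (nat ugraph \<times> nat operator) set).
        sigma_infty G' H') - ess_spectrum (verts G) (adjacency_op G) \<noteq> {}"
proof (intro exI conjI)
  show "is_graph (tree_on wedge)" by (rule is_graph_tree_on)
  show "to_nat (0::int, 0::nat) \<in> verts (tree_on wedge)" by (simp add: wedge_def)
  have "inj (\<lambda>n. to_nat (int n, 0::nat))" by (simp add: inj_def)
  then have "infinite (range (\<lambda>n. to_nat (int n, 0::nat)))" by (rule range_inj_infinite)
  moreover have "range (\<lambda>n. to_nat (int n, 0::nat)) \<subseteq> verts (tree_on wedge)"
    by (auto simp: wedge_def)
  ultimately show "infinite (verts (tree_on wedge))" using infinite_super by blast
  show "connected_graph (tree_on wedge)" by (rule connected_wedge)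
  show "degree_bounded 3 (tree_on wedge)" by (rule degree_bounded_tree_on)
  show "subexponential_growth (tree_on wedge) (to_nat (0::int, 0::nat))"
    by (rule subexponential_wedge)
  \<comment> \<open>Since \<open>3\<close> lies in the resolvent set, it avoids the whole spectrum
    and in particular its essential part.\<close>
  have "3 \<notin> ess_spectrum (verts (tree_on wedge)) (adjacency_op (tree_on wedge))"
    using three_in_resolvent_tree_on by (auto simp: ess_spectrum_def spectrum_def)
  then show "(\<Union>(G', H') \<in> (R_limits (tree_on wedge) (to_nat (0::int, 0::nat))
        (adjacency_op (tree_on wedge)) :: (nat ugraph \<times> nat operator) set). sigma_infty G' H')
      - ess_spectrum (verts (tree_on wedge)) (adjacency_op (tree_on wedge)) \<noteq> {}"
    using tree_is_R_limit three_in_sigma_infty_tree by fast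
qed

end
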